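(* Let $d\ge2$, let $\varphi_1,\ldots,\varphi_d:\mathbb{R}^d\to\mathbb{R}$ be $C^2$ mappings, let $\mathsf{H}(x)=(\varphi_1(x),\ldots,\varphi_d(x))$, and let $\Sigma=\{x\in\mathbb{R}^d:\operatorname{rank}D_x\mathsf{H}(x)\leq d-1\}$. Suppose that $E\subset\mathbb{R}^d$ is a Borel $1$-rectifiable set satisfying $$\mathcal{H}^1\big(E\setminus\Sigma\big)>0.$$ Then there exists some $j^*\in\{1,\ldots,d\}$ such that $$\mathcal{H}^1\big(\varphi_{j^*}(E)\big)>0.$$
   Context: $\mathcal{H}^1$ is $1$-dimensional Hausdorff measure. A Borel set $E\subseteq\mathbb{R}^d$ is $1$-rectifiable if there are Lipschitz maps $f_j:\mathbb{R}\to\mathbb{R}^d$, $j\in\mathbb{N}$, with $\mathcal{H}^1(E\setminus\bigcup_j f_j(\mathbb{R}))=0$. $D_x\mathsf{H}(x)$ denotes the derivative (Jacobian matrix) of $\mathsf{H}$ at $x$. *)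

theory Defs
  imports "HOL-Analysis.Analysis"
begin

text \<open>
  One-dimensional Hausdorff (outer) measure. It is defined on all subsets, since images of Borel
  sets under \<open>C\<^sup>2\<close> maps need not be Borel. No normalising factor occurs: in dimension one
  the constant is 1. The covering sets are required to be bounded because
  the library constant \<^const>\<open>diameter\<close> is only meaningful on bounded sets.
\<close>

definition hausdorff1_pre :: "real \<Rightarrow> 'a::metric_space set \<Rightarrow> ennreal" where
  "hausdorff1_pre \<delta> A =
     (INF U \<in> {U :: nat \<Rightarrow> 'a set. A \<subseteq> (\<Union>i. U i) \<and> (\<forall>i. bounded (U i) \<and> diameter (U i) \<le> \<delta>)}.
        (\<Sum>i. ennreal (diameter (U i))))"

definition hausdorff1 :: "'a::metric_space set \<Rightarrow> ennreal" where
  "hausdorff1 A = (SUP \<delta> \<in> {0<..}. hausdorff1_pre \<delta> A)"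

definition rectifiable1 :: "'a::euclidean_space set \<Rightarrow> bool" where
  "rectifiable1 E \<longleftrightarrow>
     (\<exists>f :: nat \<Rightarrow> real \<Rightarrow> 'a.
        (\<forall>j. \<exists>L. L-lipschitz_on UNIV (f j)) \<and> hausdorff1 (E - (\<Union>j. range (f j))) = 0)"

definition C2_map :: "('a::real_normed_vector \<Rightarrow> 'b::real_normed_vector) \<Rightarrow> bool" where
  "C2_map f \<longleftrightarrow>
     (\<exists>(f' :: 'a \<Rightarrow> 'a \<Rightarrow>\<^sub>L 'b) (f'' :: 'a \<Rightarrow> 'a \<Rightarrow>\<^sub>L 'a \<Rightarrow>\<^sub>L 'b).
        (\<forall>x. (f has_derivative blinfun_apply (f' x)) (at x)) \<and>
        (\<forall>x. (f' has_derivative blinfun_apply (f'' x)) (at x)) \<and>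
        continuous_on UNIV f'')"

end

theory Submission
  imports Defs
begin

text \<open>
  Suppose that all the images \<open>\<phi>\<^sub>j(E)\<close> are null. If \<open>g\<close> is Lipschitz on the line and
  \<open>g(A)\<close> is null for a measurable \<open>A\<close>, then the oscillation of \<open>g\<close> on an interval \<open>I\<close>
  is at most a constant times the measure of \<open>I - A\<close>. Covering \<open>A\<close> by nonoverlapping intervals
  inside an open set that is only slightly larger, a curve all of whose coordinates map \<open>A\<close> to
  null sets therefore maps \<open>A\<close> to an \<open>\<H>\<^sup>1\<close>-null set; no differentiability of the
  curve is needed. This applies to the curves \<open>H \<circ> f\<^sub>k\<close> with \<open>A\<close> the preimage of \<open>E\<close>.
  Off \<open>\<Sigma>\<close> the map \<open>H\<close> locally expands distances up to a constant, so the
  corresponding pieces of \<open>E - \<Sigma>\<close> are null as well, and countably many pieces suffice.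
\<close>

section \<open>Sets of one-dimensional Hausdorff measure zero\<close>

text \<open>For null sets the mesh bound disappears: every diameter is at most the total, so a cover
  with total at most \<open>min e \<delta>\<close> automatically has mesh at most
  \<open>\<delta>\<close>.\<close>

lemma hausdorff1_eq_0_iff:
  fixes A :: "'a::metric_space set"
  shows "hausdorff1 A = 0 \<longleftrightarrow>
    (\<forall>e>0. \<exists>U::nat \<Rightarrow> 'a set. A \<subseteq> (\<Union>i. U i) \<and> (\<forall>i. bounded (U i)) \<and>
       (\<Sum>i. ennreal (diameter (U i))) \<le> ennreal e)"
    (is "?L \<longleftrightarrow> ?R")
proof
  assume L: ?L
  show ?R
  proof (intro allI impI)
    fix e :: real
    assume "e > 0"
    have "hausdorff1_pre 1 A \<le> hausdorff1 A"
      unfolding hausdorff1_def by (rule SUP_upper) simp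
    then have "hausdorff1_pre 1 A < ennreal e"
      using L \<open>e > 0\<close> by simp
    then show "\<exists>U::nat \<Rightarrow> 'a set. A \<subseteq> (\<Union>i. U i) \<and> (\<forall>i. bounded (U i)) \<and>
       (\<Sum>i. ennreal (diameter (U i))) \<le> ennreal e"
      unfolding hausdorff1_pre_def INF_less_iff by (auto intro: less_imp_le)
  qed
next
  assume R: ?R
  have "hausdorff1_pre \<delta> A \<le> 0" if "\<delta> > 0" for \<delta>
  proof (rule ennreal_le_epsilon)
    fix e :: real
    assume "e > 0"
    obtain U :: "nat \<Rightarrow> 'a set" where U: "A \<subseteq> (\<Union>i. U i)" "\<And>i. bounded (U i)"
      and sum: "(\<Sum>i. ennreal (diameter (U i))) \<le> ennreal (min e \<delta>)"
      using R \<open>e > 0\<close> \<open>\<delta> > 0\<close> by (metis min_less_iff_conj)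
    have "diameter (U i) \<le> \<delta>" for i
    proof -
      have "ennreal (diameter (U i)) \<le> (\<Sum>i. ennreal (diameter (U i)))"
        using sum_le_suminf[of "\<lambda>i. ennreal (diameter (U i))" "{i}"] by simp
      also have "\<dots> \<le> ennreal \<delta>"
        using sum by (rule order_trans) (simp add: ennreal_leI)
      finally show ?thesis
        using \<open>\<delta> > 0\<close> by simp
    qed
    then have "hausdorff1_pre \<delta> A \<le> (\<Sum>i. ennreal (diameter (U i)))"
      unfolding hausdorff1_pre_def using U by (intro INF_lower) simp
    also have "\<dots> \<le> 0 + ennreal e"
      using sum by (rule order_trans) (simp add: ennreal_leI)
    finally show "hausdorff1_pre \<delta> A \<le> 0 + ennreal e" .
  qed
  then have "hausdorff1 A \<le> 0"
    unfolding hausdorff1_def by (intro SUP_least) simp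
  then show ?L
    by simp
qed

text \<open>Suited to covers by countable families of intervals, which come with no enumeration and
  are controlled through finite subfamilies.\<close>

lemma hausdorff1_eq_0I:
  fixes A :: "'a::metric_space set"
  assumes "\<And>e. e > 0 \<Longrightarrow> \<exists>(I::'i set) V. countable I \<and> A \<subseteq> (\<Union>i\<in>I. V i) \<and>
      (\<forall>i\<in>I. bounded (V i)) \<and> (\<forall>J. finite J \<longrightarrow> J \<subseteq> I \<longrightarrow> (\<Sum>i\<in>J. diameter (V i)) \<le> e)"
  shows "hausdorff1 A = 0"
  unfolding hausdorff1_eq_0_iff
proof (intro allI impI)
  fix e :: real
  assume "e > 0"
  then obtain I :: "'i set" and V where I: "countable I" and A: "A \<subseteq> (\<Union>i\<in>I. V i)"
    and bdd: "\<And>i. i \<in> I \<Longrightarrow> bounded (V i)"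
    and V: "\<And>J. finite J \<Longrightarrow> J \<subseteq> I \<Longrightarrow> (\<Sum>i\<in>J. diameter (V i)) \<le> e"
    using assms by metis
  let ?r = "to_nat_on I"
  \<comment> \<open>Numbers that encode no index receive the empty set, whose diameter is 0, so
    reindexing leaves the sums unchanged.\<close>
  define U where "U n = (if n \<in> ?r ` I then V (from_nat_into I n) else {})" for n
  have U: "U (?r i) = V i" if "i \<in> I" for i
    using that I by (simp add: U_def)
  have "(\<Sum>n<N. ennreal (diameter (U n))) \<le> ennreal e" for N
  proof -
    let ?J = "{i \<in> I. ?r i < N}"
    have J: "inj_on ?r ?J"
      using inj_on_to_nat_on[OF I] by (rule inj_on_subset) auto
    have "finite (?r ` ?J)"
      by (rule finite_subset[of _ "{..<N}"]) auto
    then have "finite ?J"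
      using J by (rule finite_imageD)
    have "(\<Sum>n<N. ennreal (diameter (U n))) = (\<Sum>n\<in>?r ` ?J. ennreal (diameter (U n)))"
      by (rule sum.mono_neutral_right) (auto simp: U_def)
    also have "\<dots> = (\<Sum>i\<in>?J. ennreal (diameter (V i)))"
      using J by (simp add: sum.reindex U)
    also have "\<dots> = ennreal (\<Sum>i\<in>?J. diameter (V i))"
      by (rule sum_ennreal) (simp add: bdd diameter_ge_0)
    also have "\<dots> \<le> ennreal e"
      using V \<open>finite ?J\<close> by (intro ennreal_leI) auto
    finally show ?thesis .
  qed
  then have "(\<Sum>n. ennreal (diameter (U n))) \<le> ennreal e"
    by (intro suminf_le_const) auto
  moreover have "A \<subseteq> (\<Union>n. U n)"
    using A U by blast
  moreover have "bounded (U n)" for n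
    using bdd I by (auto simp: U_def)
  ultimately show "\<exists>U. A \<subseteq> (\<Union>i. U i) \<and> (\<forall>i. bounded (U i)) \<and>
       (\<Sum>i. ennreal (diameter (U i))) \<le> ennreal e"
    by blast
qed

lemma hausdorff1_null_subset:
  fixes A B :: "'a::metric_space set"
  assumes "hausdorff1 B = 0" "A \<subseteq> B"
  shows "hausdorff1 A = 0"
  unfolding hausdorff1_eq_0_iff
proof (intro allI impI)
  fix e :: real
  assume "e > 0"
  then obtain U :: "nat \<Rightarrow> 'a set" where "B \<subseteq> (\<Union>i. U i)" "\<And>i. bounded (U i)"
      "(\<Sum>i. ennreal (diameter (U i))) \<le> ennreal e"
    using assms(1) unfolding hausdorff1_eq_0_iff by blast
  with assms(2) show "\<exists>U. A \<subseteq> (\<Union>i. U i) \<and> (\<forall>i. bounded (U i)) \<and>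
       (\<Sum>i. ennreal (diameter (U i))) \<le> ennreal e"
    by blast
qed

lemma hausdorff1_null_UN_nat:
  fixes A :: "nat \<Rightarrow> 'a::metric_space set"
  assumes "\<And>k. hausdorff1 (A k) = 0"
  shows "hausdorff1 (\<Union>k. A k) = 0"
  unfolding hausdorff1_eq_0_iff
proof (intro allI impI)
  fix e :: real
  assume "e > 0"
  \<comment> \<open>The exponent \<open>Suc k\<close> makes the tolerances add up to exactly
    \<open>e\<close>.\<close>
  then have "\<exists>U::nat \<Rightarrow> 'a set. A k \<subseteq> (\<Union>i. U i) \<and> (\<forall>i. bounded (U i)) \<and>
       (\<Sum>i. ennreal (diameter (U i))) \<le> ennreal (e * (1/2)^Suc k)" for k
    using assms[of k] unfolding hausdorff1_eq_0_iff by simp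
  then obtain U :: "nat \<Rightarrow> nat \<Rightarrow> 'a set" where U: "\<And>k. A k \<subseteq> (\<Union>i. U k i)"
    and bdd: "\<And>k i. bounded (U k i)"
    and sum: "\<And>k. (\<Sum>i. ennreal (diameter (U k i))) \<le> ennreal (e * (1/2)^Suc k)"
    by metis
  define W where "W n = case_prod U (prod_decode n)" for n
  have "(\<Sum>n. ennreal (diameter (W n))) = (\<Sum>k. \<Sum>i. ennreal (diameter (U k i)))"
    unfolding W_def
    by (subst suminf_ennreal_2dimen[of _ "\<lambda>p. ennreal (diameter (case_prod U p))"]) auto
  also have "\<dots> \<le> (\<Sum>k. ennreal (e * (1/2)^Suc k))"
    by (rule suminf_le) (use sum in auto)
  also have "\<dots> = ennreal e"
  proof (rule suminf_ennreal_eq)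
    show "(\<lambda>k. e * (1/2)^Suc k) sums e"
      using sums_mult[OF power_half_series, of e] by simp
  qed (use \<open>e > 0\<close> in simp)
  finally have "(\<Sum>n. ennreal (diameter (W n))) \<le> ennreal e" .
  moreover have "(\<Union>k. A k) \<subseteq> (\<Union>n. W n)"
  proof
    fix x
    assume "x \<in> (\<Union>k. A k)"
    then obtain k i where "x \<in> U k i"
      using U by blast
    then have "x \<in> W (prod_encode (k, i))"
      by (simp add: W_def)
    then show "x \<in> (\<Union>n. W n)"
      by blast
  qed
  moreover have "bounded (W n)" for n
    using bdd by (simp add: W_def split_beta)
  ultimately show "\<exists>U. (\<Union>k. A k) \<subseteq> (\<Union>i. U i) \<and> (\<forall>i. bounded (U i)) \<and>
       (\<Sum>i. ennreal (diameter (U i))) \<le> ennreal e"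
    by blast
qed

lemma hausdorff1_null_empty [simp]: "hausdorff1 {} = 0"
  unfolding hausdorff1_eq_0_iff by (intro allI impI exI[of _ "\<lambda>_. {}"]) simp

lemma hausdorff1_null_UN:
  assumes "countable I" "\<And>i. i \<in> I \<Longrightarrow> hausdorff1 (A i) = 0"
  shows "hausdorff1 (\<Union>i\<in>I. A i) = 0"
proof (cases "I = {}")
  case False
  have "hausdorff1 (\<Union>n. A (from_nat_into I n)) = 0"
    by (rule hausdorff1_null_UN_nat) (simp add: assms from_nat_into False)
  moreover have "(\<Union>i\<in>I. A i) = (\<Union>n. A (from_nat_into I n))"
    using range_from_nat_into[OF False assms(1)] by (metis image_image)
  ultimately show ?thesis
    by simp
qed simp

lemma hausdorff1_null_Un:
  assumes "hausdorff1 A = 0" "hausdorff1 B = 0"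
  shows "hausdorff1 (A \<union> B) = 0"
  using hausdorff1_null_UN[of "{A, B}" id] assms by auto

text \<open>On \<open>X\<close> the map \<open>H\<close> is injective with a
  \<open>C\<close>-Lipschitz inverse, so pulling back a cover of the image multiplies diameters by
  at most \<open>C\<close>.\<close>

lemma hausdorff1_null_expanding_preimage:
  fixes H :: "'a::real_normed_vector \<Rightarrow> 'b::metric_space"
  assumes "C > 0" and H: "\<And>x y. x \<in> X \<Longrightarrow> y \<in> X \<Longrightarrow> dist x y \<le> C * dist (H x) (H y)"
    and "hausdorff1 (H ` X) = 0"
  shows "hausdorff1 X = 0"
  unfolding hausdorff1_eq_0_iff
proof (intro allI impI)
  fix e :: real
  assume "e > 0"
  then obtain U :: "nat \<Rightarrow> 'b set" where U: "H ` X \<subseteq> (\<Union>i. U i)" "\<And>i. bounded (U i)"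
    and sum: "(\<Sum>i. ennreal (diameter (U i))) \<le> ennreal (e / C)"
    using assms unfolding hausdorff1_eq_0_iff by (meson divide_pos_pos)
  let ?V = "\<lambda>i. X \<inter> H -` U i"
  have le: "dist x y \<le> C * diameter (U i)" if "x \<in> ?V i" "y \<in> ?V i" for x y i
  proof -
    have "dist x y \<le> C * dist (H x) (H y)"
      using H that by blast
    also have "\<dots> \<le> C * diameter (U i)"
      using that U(2) \<open>C > 0\<close> by (intro mult_left_mono diameter_bounded_bound) auto
    finally show ?thesis .
  qed
  have diam: "diameter (?V i) \<le> C * diameter (U i)" for i
    using le \<open>C > 0\<close> U(2) by (intro diameter_le) (auto simp: diameter_ge_0 dist_norm)
  have "(\<Sum>i. ennreal (diameter (?V i))) \<le> (\<Sum>i. ennreal C * ennreal (diameter (U i)))"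
  proof (rule suminf_le)
    show "ennreal (diameter (?V i)) \<le> ennreal C * ennreal (diameter (U i))" for i
      using diam[of i] \<open>C > 0\<close> U(2)[of i] by (simp add: diameter_ge_0 flip: ennreal_mult')
  qed auto
  also have "\<dots> \<le> ennreal C * ennreal (e / C)"
    using sum by (simp add: mult_left_mono)
  also have "\<dots> = ennreal e"
    using \<open>C > 0\<close> by (simp flip: ennreal_mult')
  finally have "(\<Sum>i. ennreal (diameter (?V i))) \<le> ennreal e" .
  moreover have "bounded (?V i)" for i
    using le unfolding bounded_two_points by blast
  moreover have "X \<subseteq> (\<Union>i. ?V i)"
    using U(1) by blast
  ultimately show "\<exists>V. X \<subseteq> (\<Union>i. V i) \<and> (\<forall>i. bounded (V i)) \<and>
       (\<Sum>i. ennreal (diameter (V i))) \<le> ennreal e"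
    by blast
qed

section \<open>Lebesgue measure on the line and Lipschitz curves\<close>

text \<open>A bounded set of reals lies in a compact interval whose length is at most its diameter.
  Only outer covers are used, so \<open>S\<close> may be a non-measurable image.\<close>

lemma hausdorff1_null_imp_negligible:
  fixes S :: "real set"
  assumes "hausdorff1 S = 0"
  shows "negligible S"
  unfolding negligible_outer_le
proof (intro allI impI)
  fix e :: real
  assume "e > 0"
  then obtain U :: "nat \<Rightarrow> real set" where U: "S \<subseteq> (\<Union>i. U i)" "\<And>i. bounded (U i)"
    and sum: "(\<Sum>i. ennreal (diameter (U i))) \<le> ennreal e"
    using assms unfolding hausdorff1_eq_0_iff by meson
  \<comment> \<open>The empty set is treated apart because its \<open>Inf\<close> and
    \<open>Sup\<close> carry no information.\<close>
  define I where "I i = (if U i = {} then {} else {Inf (U i)..Sup (U i)})" for i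
  have sub: "U i \<subseteq> I i" for i
  proof
    fix x
    assume x: "x \<in> U i"
    then have "Inf (U i) \<le> x" "x \<le> Sup (U i)"
      by (simp_all add: cInf_lower cSup_upper U(2) bounded_imp_bdd_above bounded_imp_bdd_below)
    then show "x \<in> I i"
      using x by (auto simp: I_def)
  qed
  have em: "emeasure lebesgue (I i) \<le> ennreal (diameter (U i))" for i
  proof (cases "U i = {}")
    case False
    have d: "\<bar>x - y\<bar> \<le> diameter (U i)" if "x \<in> U i" "y \<in> U i" for x y
      using diameter_bounded_bound[OF U(2)] that by (simp add: dist_real_def)
    have "Sup (U i) \<le> Inf (U i) + diameter (U i)"
    proof (rule cSup_least[OF False])
      fix x
      assume "x \<in> U i"
      have "x - diameter (U i) \<le> Inf (U i)"
      proof (rule cInf_greatest[OF False])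
        show "x - diameter (U i) \<le> y" if "y \<in> U i" for y
          using d[OF \<open>x \<in> U i\<close> that] by simp
      qed
      then show "x \<le> Inf (U i) + diameter (U i)"
        by simp
    qed
    moreover have "Inf (U i) \<le> Sup (U i)"
      using False U(2) by (intro cInf_le_cSup bounded_imp_bdd_above bounded_imp_bdd_below) auto
    ultimately show ?thesis
      using False by (simp add: I_def ennreal_leI)
  qed (simp add: I_def)
  have meas: "I i \<in> sets lebesgue" for i
    by (simp add: I_def)
  have "emeasure lebesgue (\<Union>i. I i) \<le> (\<Sum>i. emeasure lebesgue (I i))"
    by (rule emeasure_subadditive_countably) (use meas in auto)
  also have "\<dots> \<le> (\<Sum>i. ennreal (diameter (U i)))"
    by (rule suminf_le) (use em in auto)
  finally have *: "emeasure lebesgue (\<Union>i. I i) \<le> ennreal e"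
    using sum by (rule order_trans)
  then have "emeasure lebesgue (\<Union>i. I i) < \<infinity>"
    by (rule le_less_trans) simp
  then have "(\<Union>i. I i) \<in> lmeasurable"
    using meas by (intro fmeasurableI sets.countable_UN) auto
  moreover have "measure lebesgue (\<Union>i. I i) \<le> e"
    unfolding measure_def using * \<open>e > 0\<close> by (intro enn2real_leI) simp_all
  moreover have "S \<subseteq> (\<Union>i. I i)"
    using U(1) UN_mono[OF order_refl sub] by (rule order_trans)
  ultimately show "\<exists>T. S \<subseteq> T \<and> T \<in> lmeasurable \<and> measure lebesgue T \<le> e"
    by (intro exI[of _ "\<Union>i. I i"]) simp
qed

text \<open>Nonoverlapping compact intervals cover \<open>S\<close> with little excess length, and
  \<open>g\<close> sends each onto a compact interval at most \<open>L\<close> times as long. Asking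
  for a superset \<open>T\<close> avoids the question whether the image of \<open>S\<close> is
  measurable.\<close>

lemma lipschitz_image_outer_measure:
  fixes g :: "real \<Rightarrow> real"
  assumes "L-lipschitz_on {a..b} g" "S \<in> lmeasurable" "S \<subseteq> {a..b}" "e > 0"
  obtains T where "T \<in> lmeasurable" "g ` S \<subseteq> T" "measure lebesgue T \<le> L * measure lebesgue S + e"
proof -
  have L: "L \<ge> 0"
    using assms(1) by (rule lipschitz_on_nonneg)
  \<comment> \<open>Dividing by \<open>L + 1\<close> also covers the case
    \<open>L = 0\<close>.\<close>
  define \<eta> where "\<eta> = e / (L + 1)"
  have \<eta>: "\<eta> > 0" "L * \<eta> \<le> e"
    using L \<open>e > 0\<close> by (simp_all add: \<eta>_def field_simps)
  obtain \<D> where \<D>: "countable \<D>"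
      "\<And>K. K \<in> \<D> \<Longrightarrow> K \<subseteq> {a..b} \<and> K \<noteq> {} \<and> (\<exists>c d. K = cbox c d)"
    and dis: "pairwise (\<lambda>A B. interior A \<inter> interior B = {}) \<D>"
    and cov: "S \<subseteq> \<Union>\<D>" "\<Union>\<D> \<in> lmeasurable" "measure lebesgue (\<Union>\<D>) \<le> measure lebesgue S + \<eta>"
    using measurable_outer_intervals_bounded[OF assms(2), of a b \<eta>] assms(3) \<eta>(1)
    unfolding cbox_interval by metis
  have K: "K \<in> lmeasurable" "convex K" if "K \<in> \<D>" for K
    using \<D>(2)[OF that] lmeasurable_cbox convex_box(1) by metis+
  have img: "g ` K \<in> lmeasurable" "measure lebesgue (g ` K) \<le> L * measure lebesgue K"
    if KD: "K \<in> \<D>" for K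
  proof -
    obtain c d where K: "K = {c..d}" "c \<le> d" "{c..d} \<subseteq> {a..b}"
      using \<D>(2)[OF KD] by (auto simp: cbox_interval)
    have lip: "L-lipschitz_on {c..d} g"
      using assms(1) K(3) by (rule lipschitz_on_subset)
    then have "continuous_on {c..d} g"
      by (rule lipschitz_on_continuous_on)
    then have "compact (g ` {c..d})" "connected (g ` {c..d})"
      by (auto intro: compact_continuous_image connected_continuous_image)
    \<comment> \<open>The image is compact and connected, hence an interval whose endpoints are
      values of \<open>g\<close>; its length is thus a single difference of values.\<close>
    then obtain u v where uv: "g ` {c..d} = {u..v}"
      by (metis connected_compact_interval_1)
    have "u \<le> v"
      using uv \<open>c \<le> d\<close> by (metis atLeastatMost_empty_iff2 image_is_empty)
    then have "u \<in> g ` {c..d}" "v \<in> g ` {c..d}"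
      using uv by auto
    then obtain s t where st: "s \<in> {c..d}" "t \<in> {c..d}" "u = g s" "v = g t"
      by blast
    have "v - u \<le> dist (g t) (g s)"
      using st by (simp add: dist_real_def)
    also have "\<dots> \<le> L * dist t s"
      using lip st by (intro lipschitz_onD) auto
    also have "\<dots> \<le> L * (d - c)"
      using st L by (intro mult_left_mono) (auto simp: dist_real_def)
    finally show "measure lebesgue (g ` K) \<le> L * measure lebesgue K"
      using \<open>u \<le> v\<close> \<open>c \<le> d\<close> by (simp add: K uv)
    show "g ` K \<in> lmeasurable"
      by (simp add: K uv)
  qed
  \<comment> \<open>A bound uniform over finite subfamilies gives both the measurability and the
    measure estimate of the full countable union.\<close>
  have bound: "measure lebesgue (\<Union>K\<in>F. g ` K) \<le> L * measure lebesgue S + e"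
    if F: "F \<subseteq> \<D>" "finite F" for F
  proof -
    have "measure lebesgue (\<Union>K\<in>F. g ` K) \<le> (\<Sum>K\<in>F. measure lebesgue (g ` K))"
      using F img by (intro measure_UNION_le) auto
    also have "\<dots> \<le> (\<Sum>K\<in>F. L * measure lebesgue K)"
      using F img by (intro sum_mono) auto
    also have "\<dots> = L * measure lebesgue (\<Union>F)"
    proof -
      \<comment> \<open>Two nonoverlapping intervals meet in a convex set with empty interior, so
        lengths add up.\<close>
      have "negligible (A \<inter> B)" if "A \<in> F" "B \<in> F" "A \<noteq> B" for A B
      proof -
        have "interior (A \<inter> B) = {}"
          using dis that F by (auto simp: pairwise_def)
        moreover have "convex (A \<inter> B)"
          using K(2) that F by (intro convex_Int) auto
        ultimately show ?thesis
          using negligible_convex_interior by blast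
      qed
      then have "measure lebesgue (\<Union>F) = (\<Sum>K\<in>F. measure lebesgue K)"
        using F K(1) by (intro measure_negligible_finite_Union pairwiseI) blast+
      then show ?thesis
        by (simp add: sum_distrib_left)
    qed
    also have "\<dots> \<le> L * (measure lebesgue S + \<eta>)"
    proof (rule mult_left_mono[OF _ L])
      have "\<Union>F \<in> sets lebesgue"
        using F K(1) by (intro sets.finite_Union) blast+
      then have "measure lebesgue (\<Union>F) \<le> measure lebesgue (\<Union>\<D>)"
        using F(1) cov(2) by (intro measure_mono_fmeasurable Union_mono)
      then show "measure lebesgue (\<Union>F) \<le> measure lebesgue S + \<eta>"
        using cov(3) by simp
    qed
    also have "\<dots> \<le> L * measure lebesgue S + e"
      using \<eta>(2) by (simp add: distrib_left)
    finally show ?thesis .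
  qed
  show ?thesis
  proof
    show "(\<Union>K\<in>\<D>. g ` K) \<in> lmeasurable"
      by (rule fmeasurable_UN_bound[OF \<D>(1) img(1) bound])
    show "g ` S \<subseteq> (\<Union>K\<in>\<D>. g ` K)"
      using cov(1) by blast
    show "measure lebesgue (\<Union>K\<in>\<D>. g ` K) \<le> L * measure lebesgue S + e"
      by (rule measure_UN_bound[OF \<D>(1) img(1) bound])
  qed
qed

text \<open>
  By connectedness the image of \<open>{c..d}\<close> contains the segment between any two of its points,
  and only the image of \<open>{c..d} - A\<close> contributes to the length of that segment.
\<close>

lemma oscillation_le_measure_complement:
  fixes g :: "real \<Rightarrow> real"
  assumes lip: "L-lipschitz_on {c..d} g" and A: "A \<in> sets lebesgue"
    and null: "negligible (g ` (A \<inter> {c..d}))" and st: "s \<in> {c..d}" "t \<in> {c..d}"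
  shows "\<bar>g s - g t\<bar> \<le> L * measure lebesgue ({c..d} - A)"
proof (rule field_le_epsilon)
  fix e :: real
  assume "e > 0"
  have "{c..d} - A \<in> lmeasurable"
    using A by (intro fmeasurable_Diff) auto
  then obtain T where T: "T \<in> lmeasurable" "g ` ({c..d} - A) \<subseteq> T"
      "measure lebesgue T \<le> L * measure lebesgue ({c..d} - A) + e"
    using lipschitz_image_outer_measure[OF lip _ _ \<open>e > 0\<close>, of "{c..d} - A"] by auto
  let ?N = "g ` (A \<inter> {c..d})"
  have N: "?N \<in> lmeasurable" "measure lebesgue ?N = 0"
    using null negligible_imp_measurable negligible_imp_measure0 by auto
  have "connected (g ` {c..d})"
    using lipschitz_on_continuous_on[OF lip] by (intro connected_continuous_image) auto
  then have "{min (g s) (g t)..max (g s) (g t)} \<subseteq> g ` {c..d}"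
    using st by (intro connected_contains_Icc) (auto simp: min_def max_def)
  also have "\<dots> \<subseteq> T \<union> ?N"
    using T(2) by blast
  finally have "measure lebesgue {min (g s) (g t)..max (g s) (g t)} \<le> measure lebesgue (T \<union> ?N)"
    using T(1) N(1) by (intro measure_mono_fmeasurable) auto
  also have "\<dots> \<le> measure lebesgue T + measure lebesgue ?N"
    using T(1) N(1) by (intro measure_Un_le) auto
  finally show "\<bar>g s - g t\<bar> \<le> L * measure lebesgue ({c..d} - A) + e"
    using T(3) N(2) by (cases "g s \<le> g t") (auto simp: max_def min_def)
qed

text \<open>The diameter of the image of a covering interval \<open>K\<close> is controlled by the
  measure of \<open>K - A\<close>, not of \<open>K\<close>. Summed over the cover, this is at most a
  constant times the measure of \<open>U - A\<close>, which is as small as desired however large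
  \<open>A\<close> is.\<close>

lemma hausdorff1_null_curve_image:
  fixes \<gamma> :: "real \<Rightarrow> real^'d::finite"
  assumes "a < b" and A: "A \<in> sets lebesgue" "A \<subseteq> {a..b}"
    and lip: "\<And>j. \<exists>L. L-lipschitz_on {a..b} (\<lambda>t. \<gamma> t $ j)"
    and null: "\<And>j. negligible ((\<lambda>t. \<gamma> t $ j) ` A)"
  shows "hausdorff1 (\<gamma> ` A) = 0"
proof (rule hausdorff1_eq_0I)
  fix e :: real
  assume "e > 0"
  obtain L where L: "\<And>j. (L j)-lipschitz_on {a..b} (\<lambda>t. \<gamma> t $ j)"
    using lip by metis
  define M where "M = (\<Sum>j\<in>UNIV. L j)"
  have M: "M \<ge> 0"
    unfolding M_def using lipschitz_on_nonneg[OF L] by (rule sum_nonneg)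
  define \<eta> where "\<eta> = e / (M + 1)"
  have \<eta>: "\<eta> > 0" "M * \<eta> \<le> e"
    using M \<open>e > 0\<close> by (simp_all add: \<eta>_def field_simps)
  obtain U where U: "open U" "A \<subseteq> U" "U - A \<in> lmeasurable"
      and "emeasure lebesgue (U - A) < ennreal \<eta>"
    using sets_lebesgue_outer_open[OF A(1) \<eta>(1)] .
  then have UA: "measure lebesgue (U - A) \<le> \<eta>"
    using \<eta>(1) by (simp add: emeasure_eq_measure2 ennreal_less_iff)
  \<comment> \<open>The covering lemma tags each interval with a point of \<open>A\<close>. As
    \<open>A\<close> lies in \<open>U\<close>, this gauge forces the intervals into
    \<open>U\<close>; the value \<open>UNIV\<close> elsewhere imposes no restriction.\<close>
  let ?g = "\<lambda>x. if x \<in> U then U else UNIV"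
  have g: "gauge ?g"
    using U(1) by (auto simp: gauge_def)
  have ab: "A \<subseteq> cbox a b" "box a b \<noteq> {}"
    using A(2) \<open>a < b\<close> by auto
  obtain \<D> where \<D>: "countable \<D>" "\<Union>\<D> \<subseteq> cbox a b"
      "\<And>K. K \<in> \<D> \<Longrightarrow> interior K \<noteq> {} \<and> (\<exists>c d. K = cbox c d)"
      "pairwise (\<lambda>A B. interior A \<inter> interior B = {}) \<D>"
    and sub: "\<And>K. K \<in> \<D> \<Longrightarrow> \<exists>x \<in> A \<inter> K. K \<subseteq> ?g x"
      "\<And>u v. cbox u v \<in> \<D> \<Longrightarrow> \<exists>n. \<forall>i \<in> Basis. v \<bullet> i - u \<bullet> i = (b \<bullet> i - a \<bullet> i) / 2^n"
    and cov: "A \<subseteq> \<Union>\<D>"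
  proof (rule covering_lemma[OF ab g], goal_cases)
    case (1 \<D>)
    show ?thesis
      by (rule 1(1)) (fact 1)+
  qed
  have KU: "K \<subseteq> U" if "K \<in> \<D>" for K
    using sub(1)[OF that] U(2) by (auto split: if_splits)
  \<comment> \<open>The oscillation estimate is applied to each coordinate; the l1 bound on the norm
    is what makes \<open>M\<close> the sum of the coordinate constants.\<close>
  have norm: "norm (\<gamma> s - \<gamma> t) \<le> M * measure lebesgue (K - A)"
    if K: "K \<in> \<D>" and st: "s \<in> K" "t \<in> K" for K s t
  proof -
    obtain c d where cd: "K = {c..d}"
      using \<D>(3)[OF K] by (auto simp: cbox_interval)
    have "norm (\<gamma> s - \<gamma> t) \<le> (\<Sum>j\<in>UNIV. \<bar>(\<gamma> s - \<gamma> t) $ j\<bar>)"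
      by (rule norm_le_l1_cart)
    also have "\<dots> \<le> (\<Sum>j\<in>UNIV. L j * measure lebesgue (K - A))"
    proof (rule sum_mono)
      fix j
      have "{c..d} \<subseteq> {a..b}"
        using Union_upper[OF K] \<D>(2) unfolding cd cbox_interval by (rule subset_trans)
      with L have "(L j)-lipschitz_on {c..d} (\<lambda>t. \<gamma> t $ j)"
        by (rule lipschitz_on_subset)
      moreover have "negligible ((\<lambda>t. \<gamma> t $ j) ` (A \<inter> {c..d}))"
        using null by (rule negligible_subset) auto
      ultimately show "\<bar>(\<gamma> s - \<gamma> t) $ j\<bar> \<le> L j * measure lebesgue (K - A)"
        using oscillation_le_measure_complement[OF _ A(1), of "L j" c d "\<lambda>t. \<gamma> t $ j" s t] st
        by (simp add: cd)
    qed
    also have "\<dots> = M * measure lebesgue (K - A)"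
      by (simp add: M_def sum_distrib_right)
    finally show ?thesis .
  qed
  have meas: "K - A \<in> lmeasurable" if "K \<in> \<D>" for K
    using \<D>(3)[OF that] A(1) by (intro fmeasurable_Diff) auto
  have "(\<Sum>K\<in>J. diameter (\<gamma> ` K)) \<le> e" if J: "finite J" "J \<subseteq> \<D>" for J
  proof -
    have "(\<Sum>K\<in>J. diameter (\<gamma> ` K)) \<le> (\<Sum>K\<in>J. M * measure lebesgue (K - A))"
      using J norm M by (intro sum_mono diameter_le) auto
    also have "\<dots> = M * (\<Sum>K\<in>J. measure lebesgue (K - A))"
      by (simp add: sum_distrib_left)
    \<comment> \<open>The sets \<open>K - A\<close> overlap only in negligible sets and all lie in
      \<open>U - A\<close>, so their measures together do not exceed that of
      \<open>U - A\<close>.\<close>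
    also have "(\<Sum>K\<in>J. measure lebesgue (K - A)) = measure lebesgue (\<Union>K\<in>J. K - A)"
    proof (rule measure_negligible_finite_Union_image[symmetric])
      have "negligible ((K - A) \<inter> (K' - A))" if "K \<in> \<D>" "K' \<in> \<D>" "K \<noteq> K'" for K K'
      proof -
        have "interior (K \<inter> K') = {}"
          using \<D>(4) that by (auto simp: pairwise_def)
        moreover have "convex (K \<inter> K')"
          using \<D>(3) that by (intro convex_Int) (metis convex_box(1))+
        ultimately have "negligible (K \<inter> K')"
          using negligible_convex_interior by blast
        then show ?thesis
          by (rule negligible_subset) auto
      qed
      then show "pairwise (\<lambda>K K'. negligible ((K - A) \<inter> (K' - A))) J"
        using J by (auto simp: pairwise_def)
    qed (use J meas in auto)
    also have "\<dots> \<le> measure lebesgue (U - A)"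
      using J KU meas U(3) by (intro measure_mono_fmeasurable sets.finite_UN) auto
    finally show ?thesis
      using UA \<eta>(2) M by (smt (verit) mult_left_mono)
  qed
  moreover have "bounded (\<gamma> ` K)" if "K \<in> \<D>" for K
    unfolding bounded_two_points using norm[OF that] by (auto simp: dist_norm)
  moreover have "\<gamma> ` A \<subseteq> (\<Union>K\<in>\<D>. \<gamma> ` K)"
    using image_mono[OF cov] by (simp only: image_Union)
  ultimately show "\<exists>(I::real set set) V. countable I \<and> \<gamma> ` A \<subseteq> (\<Union>i\<in>I. V i) \<and>
      (\<forall>i\<in>I. bounded (V i)) \<and> (\<forall>J. finite J \<longrightarrow> J \<subseteq> I \<longrightarrow> (\<Sum>i\<in>J. diameter (V i)) \<le> e)"
    using \<D>(1) by (intro exI[of _ \<D>] exI[of _ "\<lambda>K. \<gamma> ` K"]) simp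
qed

section \<open>Local expansion and local Lipschitz bounds for continuously differentiable
  maps\<close>

text \<open>The injective linear map \<open>H' x\<close> stretches by at least some
  \<open>c > 0\<close>. Near \<open>x\<close> the remainder of \<open>H\<close> after subtracting
  \<open>H' x\<close> is \<open>c/2\<close>-Lipschitz by the mean value inequality, which leaves
  expansion by at least \<open>c/2\<close>.\<close>

lemma C1_locally_expanding:
  fixes H :: "'a::euclidean_space \<Rightarrow> 'b::euclidean_space"
  assumes der: "\<And>x. (H has_derivative H' x) (at x)"
    and cont: "\<And>e. e > 0 \<Longrightarrow>
      \<forall>\<^sub>F y in nhds x. \<forall>h. norm (H' y h - H' x h) \<le> e * norm h"
    and "inj (H' x)"
  obtains r C where "r > 0" "C > 0"
    "\<And>y z. y \<in> ball x r \<Longrightarrow> z \<in> ball x r \<Longrightarrow> dist y z \<le> C * dist (H y) (H z)"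
proof -
  have lin: "bounded_linear (H' y)" for y
    using der by (rule has_derivative_bounded_linear)
  then obtain c where c: "c > 0" "\<And>h. c * norm h \<le> norm (H' x h)"
    using linear_inj_bounded_below_pos \<open>inj (H' x)\<close> bounded_linear.linear by metis
  obtain r where r: "r > 0" "\<And>y h. y \<in> ball x r \<Longrightarrow> norm (H' y h - H' x h) \<le> c/2 * norm h"
    using cont[of "c/2"] c(1) by (auto simp: eventually_nhds_metric dist_commute)
  have "dist y z \<le> 2/c * dist (H y) (H z)" if yz: "y \<in> ball x r" "z \<in> ball x r" for y z
  proof -
    have "norm ((H y - H' x y) - (H z - H' x z)) \<le> c/2 * norm (y - z)"
    proof (rule differentiable_bound[OF convex_ball _ _ yz])
      fix w
      assume w: "w \<in> ball x r"
      have "((\<lambda>y. H y - H' x y) has_derivative (\<lambda>h. H' w h - H' x h)) (at w)"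
        using der lin by (intro has_derivative_diff bounded_linear_imp_has_derivative)
      then show "((\<lambda>y. H y - H' x y) has_derivative (\<lambda>h. H' w h - H' x h)) (at w within ball x r)"
        by (rule has_derivative_at_withinI)
      show "onorm (\<lambda>h. H' w h - H' x h) \<le> c/2"
        using r(2)[OF w] c(1) by (intro onorm_le)
    qed
    moreover have "H' x y - H' x z = H' x (y - z)"
      using bounded_linear.linear[OF lin] by (simp add: linear_diff)
    then have "c * norm (y - z) \<le> norm (H' x y - H' x z)"
      using c(2)[of "y - z"] by simp
    moreover have "norm (H' x y - H' x z) \<le>
        norm (H y - H z) + norm ((H y - H' x y) - (H z - H' x z))"
      using norm_triangle_ineq4[of "H y - H z" "(H y - H' x y) - (H z - H' x z)"]
      by (simp add: algebra_simps)
    ultimately have "c/2 * norm (y - z) \<le> norm (H y - H z)"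
      by simp
    then show ?thesis
      using c(1) by (simp add: dist_norm field_simps)
  qed
  then show ?thesis
    using that[OF r(1), of "2/c"] c(1) by auto
qed

text \<open>The derivative is bounded on the compact ball, and convexity allows the mean value
  inequality. The functions \<open>\<phi> j\<close> need not be globally Lipschitz, so their
  composites with the curves are treated on bounded parameter intervals.\<close>

lemma C1_lipschitz_on_cball:
  fixes f :: "'a::euclidean_space \<Rightarrow> 'b::real_normed_vector" and f' :: "'a \<Rightarrow> 'a \<Rightarrow>\<^sub>L 'b"
  assumes "\<And>x. (f has_derivative blinfun_apply (f' x)) (at x)" "continuous_on UNIV f'"
  shows "\<exists>L. L-lipschitz_on (cball a r) f"
proof -
  have "bounded (f' ` cball a r)"
    using assms(2) by (intro compact_imp_bounded compact_continuous_image)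
      (auto intro: continuous_on_subset)
  then obtain B where B: "B > 0" "\<And>x. x \<in> cball a r \<Longrightarrow> norm (f' x) \<le> B"
    by (auto simp: bounded_pos)
  have "norm (f x - f y) \<le> B * norm (x - y)" if "x \<in> cball a r" "y \<in> cball a r" for x y
    using that assms(1) B(2)
    by (intro differentiable_bound[OF convex_cball, where f' = "\<lambda>x. blinfun_apply (f' x)"])
      (auto intro: has_derivative_at_withinI simp: norm_blinfun.rep_eq)
  then have "B-lipschitz_on (cball a r) f"
    using B(1) by (intro lipschitz_onI) (auto simp: dist_norm)
  then show ?thesis ..
qed

lemma C2_map_imp_C1:
  assumes "C2_map f"
  obtains f' where "\<And>x. (f has_derivative blinfun_apply (f' x)) (at x)" "continuous_on UNIV f'"
proof -
  obtain f' f'' where f': "\<And>x. (f has_derivative blinfun_apply (f' x)) (at x)"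
      "\<And>x. (f' has_derivative blinfun_apply (f'' x)) (at x)"
    using assms unfolding C2_map_def by metis
  have "continuous_on UNIV f'"
    using has_derivative_continuous[OF f'(2)] by (simp add: continuous_at_imp_continuous_on)
  with f'(1) show ?thesis
    by (rule that)
qed

theorem corollary4p3:
  fixes \<phi> :: "'d::finite \<Rightarrow> real^'d \<Rightarrow> real"
    and H :: "real^'d \<Rightarrow> real^'d"
    and \<Sigma> E :: "(real^'d) set"
  assumes "CARD('d) \<ge> 2"
    and "\<And>j. C2_map (\<phi> j)"
    and "H = (\<lambda>x. \<chi> j. \<phi> j x)"
    and "\<Sigma> = {x. rank (jacobian H (at x)) \<le> CARD('d) - 1}"
    and "E \<in> sets borel"
    and "rectifiable1 E"
    and "hausdorff1 (E - \<Sigma>) > 0"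
  shows "\<exists>j. hausdorff1 (\<phi> j ` E) > 0"
proof (rule ccontr)
  assume "\<not> ?thesis"
  then have "hausdorff1 (\<phi> j ` E) = 0" for j
    by (simp add: not_gr_zero)
  then have null: "negligible (\<phi> j ` E)" for j
    by (rule hausdorff1_null_imp_negligible)
  have "\<exists>f'. (\<forall>x. (\<phi> j has_derivative blinfun_apply (f' x)) (at x)) \<and> continuous_on UNIV f'" for j
    using C2_map_imp_C1[OF assms(2)[of j]] by metis
  then obtain \<phi>' where \<phi>': "\<And>j x. (\<phi> j has_derivative blinfun_apply (\<phi>' j x)) (at x)"
      and cont: "\<And>j. continuous_on UNIV (\<phi>' j)"
    by metis
  let ?H' = "\<lambda>x h. \<chi> j. blinfun_apply (\<phi>' j x) h"
  have H': "(H has_derivative ?H' x) (at x)" for x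
    unfolding assms(3) using \<phi>'
    by (subst has_derivative_componentwise_within) (auto simp: Basis_vec_def inner_axis)
  have inj: "inj (?H' x)" if "x \<notin> \<Sigma>" for x
  proof -
    \<comment> \<open>Off \<open>\<Sigma>\<close> the rank exceeds \<open>CARD('d) - 1\<close>, and
      it cannot exceed the size of the matrix.\<close>
    have "rank (jacobian H (at x)) = CARD('d)"
      using that rank_bound[of "jacobian H (at x)"] unfolding assms(4) by simp
    then have "inj ((*v) (jacobian H (at x)))"
      by (simp add: full_rank_injective)
    \<comment> \<open>Uniqueness of the derivative transfers injectivity from the Jacobian matrix to
      the explicit derivative \<open>?H' x\<close>.\<close>
    moreover have "(H has_derivative ((*v) (jacobian H (at x)))) (at x)"
      using H' jacobian_works differentiableI by blast
    ultimately show ?thesis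
      using has_derivative_unique[OF H'] by metis
  qed
  have evt: "\<forall>\<^sub>F y in nhds x. \<forall>h. norm (?H' y h - ?H' x h) \<le> e * norm h" if "e > 0" for x e
  proof -
    \<comment> \<open>This sum dominates the operator norm of the difference of derivatives; it is
      continuous in \<open>y\<close> and vanishes at \<open>x\<close>.\<close>
    let ?S = "\<lambda>y. \<Sum>j\<in>UNIV. norm (\<phi>' j y - \<phi>' j x)"
    have "isCont ?S x"
      using cont by (intro continuous_intros) (auto simp: continuous_on_eq_continuous_at)
    then have "(?S \<longlongrightarrow> ?S x) (nhds x)"
      unfolding isCont_def using tendsto_at_iff_tendsto_nhds[of ?S x] by blast
    then have "\<forall>\<^sub>F y in nhds x. ?S y < e"
      by (rule order_tendstoD(2)) (use \<open>e > 0\<close> in simp)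
    then show ?thesis
    proof (rule eventually_mono, intro allI)
      fix y h
      assume S: "?S y < e"
      have "norm (?H' y h - ?H' x h) \<le> (\<Sum>j\<in>UNIV. \<bar>(?H' y h - ?H' x h) $ j\<bar>)"
        by (rule norm_le_l1_cart)
      also have "\<dots> \<le> (\<Sum>j\<in>UNIV. norm (\<phi>' j y - \<phi>' j x) * norm h)"
      proof (rule sum_mono)
        fix j
        show "\<bar>(?H' y h - ?H' x h) $ j\<bar> \<le> norm (\<phi>' j y - \<phi>' j x) * norm h"
          using norm_blinfun[of "\<phi>' j y - \<phi>' j x" h] by (simp add: blinfun.diff_left)
      qed
      also have "\<dots> = ?S y * norm h"
        by (simp add: sum_distrib_right)
      also have "\<dots> \<le> e * norm h"
        using S by (intro mult_right_mono) auto
      finally show "norm (?H' y h - ?H' x h) \<le> e * norm h" .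
    qed
  qed
  \<comment> \<open>The constant may vary with the set, so expansion is a property of single open
    sets and the Lindelof property extracts countably many of them.\<close>
  define expanding where
    "expanding B \<longleftrightarrow> (\<exists>C>0. \<forall>y\<in>B. \<forall>z\<in>B. dist y z \<le> C * dist (H y) (H z))" for B
  obtain \<B> where \<B>: "\<B> \<subseteq> {B. open B \<and> expanding B}" "countable \<B>"
      and UN\<B>: "\<Union>\<B> = \<Union>{B. open B \<and> expanding B}"
    using Lindelof[of "{B. open B \<and> expanding B}"] by blast
  have cover: "x \<in> \<Union>\<B>" if x: "x \<notin> \<Sigma>" for x
  proof -
    obtain r C where "r > 0" "C > 0"
        "\<And>y z. y \<in> ball x r \<Longrightarrow> z \<in> ball x r \<Longrightarrow> dist y z \<le> C * dist (H y) (H z)"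
      using C1_locally_expanding[OF H' evt inj[OF x]] by blast
    then have "open (ball x r)" "expanding (ball x r)" "x \<in> ball x r"
      by (auto simp: expanding_def)
    then show ?thesis
      unfolding UN\<B> by blast
  qed
  obtain f :: "nat \<Rightarrow> real \<Rightarrow> real^'d" where f: "\<And>k. \<exists>L. L-lipschitz_on UNIV (f k)"
      and rest: "hausdorff1 (E - (\<Union>k. range (f k))) = 0"
    using assms(6) unfolding rectifiable1_def by blast
  \<comment> \<open>Bounded parameter intervals keep each piece of curve in a ball on which every
    \<open>\<phi> j\<close> is Lipschitz. Using \<open>Suc n\<close> keeps the interval
    nondegenerate for \<open>n = 0\<close>.\<close>
  define A where "A k B n = f k -` (E \<inter> B) \<inter> {- real (Suc n)..real (Suc n)}" for k B n
  have piece: "hausdorff1 (f k ` A k B n) = 0" if B: "B \<in> \<B>" for k B n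
  proof -
    let ?I = "{- real (Suc n)..real (Suc n)}"
    obtain L where L: "L-lipschitz_on UNIV (f k)"
      using f by blast
    then have fcont: "continuous_on UNIV (f k)"
      by (rule lipschitz_on_continuous_on)
    have "open B"
      using \<B>(1) B by blast
    \<comment> \<open>Here the Borel hypothesis on \<open>E\<close> enters: it makes the parameter
      set measurable.\<close>
    have "f k -` (E \<inter> B) \<inter> space borel \<in> sets borel"
      using borel_measurable_continuous_onI[OF fcont] assms(5) \<open>open B\<close>
      by (intro measurable_sets sets.Int) auto
    then have meas: "A k B n \<in> sets lebesgue"
      unfolding A_def by (intro sets.Int) auto
    have "bounded (f k ` ?I)"
      using fcont by (intro compact_imp_bounded compact_continuous_image)
        (auto intro: continuous_on_subset)
    then obtain p r where r: "f k ` ?I \<subseteq> cball p r"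
      by (meson bounded_subset_cball)
    have lip: "\<exists>M. M-lipschitz_on ?I (\<lambda>t. H (f k t) $ j)" for j
    proof -
      obtain M where "M-lipschitz_on (cball p r) (\<phi> j)"
        using C1_lipschitz_on_cball[OF \<phi>' cont] by blast
      then have "M-lipschitz_on (f k ` ?I) (\<phi> j)"
        using r by (rule lipschitz_on_subset)
      then have "(M * L)-lipschitz_on ?I (\<phi> j \<circ> f k)"
        using L by (intro lipschitz_on_compose) (auto intro: lipschitz_on_subset)
      then show ?thesis
        by (auto simp: assms(3) comp_def)
    qed
    \<comment> \<open>Parameters in \<open>A k B n\<close> are sent into \<open>E\<close>, so the
      coordinate image lies in the negligible image of \<open>E\<close> under
      \<open>\<phi> j\<close>.\<close>
    have "negligible ((\<lambda>t. H (f k t) $ j) ` A k B n)" for j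
      using null[of j] by (rule negligible_subset) (auto simp: assms(3) A_def)
    then have "hausdorff1 ((\<lambda>t. H (f k t)) ` A k B n) = 0"
      using meas lip by (intro hausdorff1_null_curve_image[of "- real (Suc n)" "real (Suc n)"])
        (auto simp: A_def)
    then have null: "hausdorff1 (H ` f k ` A k B n) = 0"
      by (simp add: image_image)
    have "expanding B"
      using \<B>(1) B by blast
    then obtain C where "C > 0" and C: "\<forall>y\<in>B. \<forall>z\<in>B. dist y z \<le> C * dist (H y) (H z)"
      unfolding expanding_def by (elim exE conjE)
    have "f k ` A k B n \<subseteq> B"
      by (auto simp: A_def)
    with C have "dist y z \<le> C * dist (H y) (H z)"
      if "y \<in> f k ` A k B n" "z \<in> f k ` A k B n" for y z
      using that by blast
    with \<open>C > 0\<close> show ?thesis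
      using null by (rule hausdorff1_null_expanding_preimage)
  qed
  have "hausdorff1 (\<Union>B\<in>\<B>. \<Union>k. \<Union>n. f k ` A k B n) = 0"
    using \<B>(2) piece by (intro hausdorff1_null_UN) auto
  with rest have "hausdorff1 ((E - (\<Union>k. range (f k))) \<union> (\<Union>B\<in>\<B>. \<Union>k. \<Union>n. f k ` A k B n)) = 0"
    by (rule hausdorff1_null_Un)
  \<comment> \<open>A point on no curve belongs to the null remainder; otherwise its parameter lies
    in one of the bounded intervals and the point in some member of \<open>\<B>\<close>.\<close>
  moreover have "E - \<Sigma> \<subseteq> (E - (\<Union>k. range (f k))) \<union> (\<Union>B\<in>\<B>. \<Union>k. \<Union>n. f k ` A k B n)"
  proof
    fix x
    assume x: "x \<in> E - \<Sigma>"
    then obtain B where B: "B \<in> \<B>" "x \<in> B"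
      using cover by blast
    show "x \<in> (E - (\<Union>k. range (f k))) \<union> (\<Union>B\<in>\<B>. \<Union>k. \<Union>n. f k ` A k B n)"
    proof (cases "x \<in> (\<Union>k. range (f k))")
      case True
      then obtain k t where t: "x = f k t"
        by blast
      obtain n where "\<bar>t\<bar> \<le> real n"
        using real_arch_simple by blast
      then have "t \<in> A k B n"
        using x B t by (auto simp: A_def)
      then show ?thesis
        using B(1) t by blast
    next
      case False
      then show ?thesis
        using x by simp
    qed
  qed
  ultimately have "hausdorff1 (E - \<Sigma>) = 0"
    by (rule hausdorff1_null_subset)
  with assms(7) show False
    by simp
qed

end
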